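(* Let $A=\{a_1,a_2\}$ and $E=\{e_1,e_2\}$ be two alphabets. Then, as formal power series in $z$, $$\sum_{n=0}^{\infty} S_n(A)\,S_{2n+1}(E)\,z^n=\frac{e_1+e_2-a_1a_2e_1^2e_2^2(e_1+e_2)z^2}{\left(\sum_{n=0}^{\infty}S_n(-A)e_1^{2n}z^n\right)\left(\sum_{n=0}^{\infty}S_n(-A)e_2^{2n}z^n\right)}.$$
   Context: Here $a_1,a_2,e_1,e_2$ are commuting variables (an alphabet is a set of variables), and identities are between formal power series in $z$ with coefficients in $\mathbb{Z}[a_1,a_2,e_1,e_2]$; the denominator has constant term $1$, so it is invertible. For an alphabet $X=\{x_1,x_2\}$, $S_n(X)$ is defined by $\sum_{n\ge 0}S_n(X)z^n=\frac{1}{(1-x_1z)(1-x_2z)}$, equivalently $S_n(X)=\frac{x_1^{n+1}-x_2^{n+1}}{x_1-x_2}$ for $n\ge 0$, and $S_n(X)=0$ for $n<0$. The quantities $S_n(-A)$ are defined by $\sum_{n\ge 0}S_n(-A)z^n=(1-a_1z)(1-a_2z)$. *)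

theory Defs
  imports "HOL-Computational_Algebra.Formal_Power_Series" "HOL-Library.Poly_Mapping"
begin

datatype variable = A1 | A2 | E1 | E2

text \<open>The polynomial ring \<open>\<int>[a\<^sub>1, a\<^sub>2, e\<^sub>1, e\<^sub>2]\<close>: finitely supported
  maps from exponent vectors to integer coefficients, with convolution as product.\<close>

type_synonym poly_ring = "(variable \<Rightarrow>\<^sub>0 nat) \<Rightarrow>\<^sub>0 int"

definition var :: "variable \<Rightarrow> poly_ring" where
  "var v = Poly_Mapping.single (Poly_Mapping.single v 1) 1"

text \<open>The overloaded \<open>inverse\<close> of formal power series needs an \<open>inverse\<close> operation on the
  coefficients, which polynomials do not have. A series with constant term 1 is nevertheless
  invertible over every commutative ring.\<close>

definition fps_recip :: "'a::comm_ring_1 fps \<Rightarrow> 'a fps" where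
  "fps_recip f = fps_right_inverse f 1"

lemma fps_recip_right: "fps_nth f 0 = 1 \<Longrightarrow> f * fps_recip f = 1"
  unfolding fps_recip_def by (rule fps_right_inverse) simp

lemma fps_recip_unique:
  assumes "fps_nth f 0 = 1" and "f * g = 1"
  shows "g = fps_recip f"
  using fps_recip_right[OF assms(1)] assms(2) by (metis mult.commute mult.left_commute mult.right_neutral)

text \<open>An alphabet is a set of pairwise different letters, so the products below have one factor
  per letter. \<open>S n X\<close> and \<open>S_neg n X\<close> stand for \<open>S\<^sub>n(X)\<close> and \<open>S\<^sub>n(-X)\<close>.\<close>

definition S :: "nat \<Rightarrow> 'a::comm_ring_1 set \<Rightarrow> 'a" where
  "S n X = fps_nth (fps_recip (\<Prod>x\<in>X. 1 - fps_const x * fps_X)) n"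

definition S_neg :: "nat \<Rightarrow> 'a::comm_ring_1 set \<Rightarrow> 'a" where
  "S_neg n X = fps_nth (\<Prod>x\<in>X. 1 - fps_const x * fps_X) n"

end

theory Submission
  imports Defs
begin

text \<open>Write \<open>D\<^sub>i\<close> for the series \<open>\<Sum>\<^sub>n S\<^sub>n(-A) e\<^sub>i\<^sup>2\<^sup>n z\<^sup>n\<close>. Its inverse is
  \<open>\<Sum>\<^sub>n S\<^sub>n(A) e\<^sub>i\<^sup>2\<^sup>n z\<^sup>n\<close>. The numbers \<open>g\<^sub>n = S\<^sub>2\<^sub>n\<^sub>+\<^sub>1(E)\<close> satisfy the first-order recurrence
  \<open>g\<^sub>n\<^sub>+\<^sub>1 = e\<^sub>1\<^sup>2 g\<^sub>n + (e\<^sub>1 + e\<^sub>2) e\<^sub>2\<^sup>2\<^sup>n\<^sup>+\<^sup>2\<close>; together with the second-order recurrence of \<open>S\<^sub>n(A)\<close> this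
  gives \<open>D\<^sub>1 \<cdot> \<Sum>\<^sub>n S\<^sub>n(A) g\<^sub>n z\<^sup>n = (e\<^sub>1 + e\<^sub>2) (1 - a\<^sub>1 a\<^sub>2 e\<^sub>1\<^sup>2 e\<^sub>2\<^sup>2 z\<^sup>2) / D\<^sub>2\<close>. No division by \<open>e\<^sub>1 - e\<^sub>2\<close> is
  needed, so the identity holds over every commutative ring.\<close>

text \<open>Keeps the two alphabets from collapsing to singletons, whose products would have only
  one factor.\<close>

lemma var_neq: "v \<noteq> w \<Longrightarrow> var v \<noteq> var w"
  unfolding var_def by (metis keys_single insertI1 singletonD zero_neq_one)

lemma prod_pair:
  fixes x y :: "'a::comm_ring_1"
  assumes "x \<noteq> y"
  shows "(\<Prod>u\<in>{x, y}. 1 - fps_const u * fps_X) =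
    1 - fps_const (x + y) * fps_X + fps_const (x * y) * fps_X\<^sup>2"
  using assms by (simp add: algebra_simps power2_eq_square flip: fps_const_add fps_const_mult)

text \<open>Reduces an identity of series to two initial values and a second-order
  recurrence.\<close>

lemma fps_nth_quadratic_mult:
  fixes f :: "'a::comm_ring_1 fps"
  defines "q s p \<equiv> 1 - fps_const s * fps_X + fps_const p * fps_X\<^sup>2"
  shows "fps_nth (q s p * f) 0 = fps_nth f 0"
    and "fps_nth (q s p * f) (Suc 0) = fps_nth f (Suc 0) - s * fps_nth f 0"
    and "fps_nth (q s p * f) (Suc (Suc n)) =
      fps_nth f (Suc (Suc n)) - s * fps_nth f (Suc n) + p * fps_nth f n"
  unfolding q_def by (simp_all add: left_diff_distrib distrib_right mult.assoc fps_X_power_mult_nth)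

lemma S_pair:
  fixes x y :: "'a::comm_ring_1"
  assumes "x \<noteq> y"
  shows "S 0 {x, y} = 1"
    and "S (Suc 0) {x, y} = x + y"
    and "S (Suc (Suc n)) {x, y} = (x + y) * S (Suc n) {x, y} - x * y * S n {x, y}"
proof -
  define q where "q = 1 - fps_const (x + y) * fps_X + fps_const (x * y) * fps_X\<^sup>2"
  have "fps_nth q 0 = 1"
    by (simp add: q_def)
  then have "q * fps_recip q = 1"
    by (rule fps_recip_right)
  then have eq: "fps_nth (q * fps_recip q) k = fps_nth 1 k" for k
    by simp
  have S: "S k {x, y} = fps_nth (fps_recip q) k" for k
    unfolding S_def prod_pair[OF assms] q_def ..
  note nth = fps_nth_quadratic_mult[of "x + y" "x * y" "fps_recip q", folded q_def]
  show 0: "S 0 {x, y} = 1"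
    using eq[of 0] by (simp only: nth S fps_one_nth) simp
  show "S (Suc 0) {x, y} = x + y"
    using eq[of "Suc 0"] 0 by (simp only: nth S fps_one_nth) (simp add: algebra_simps)
  show "S (Suc (Suc n)) {x, y} = (x + y) * S (Suc n) {x, y} - x * y * S n {x, y}"
    using eq[of "Suc (Suc n)"] by (simp only: nth S fps_one_nth) (simp add: algebra_simps)
qed

text \<open>\<open>S n {x, y}\<close> is the sum of all monomials of degree \<open>n\<close>; in
  degree \<open>n + 1\<close> only \<open>y ^ Suc n\<close> is not divisible by
  \<open>x\<close>.\<close>

lemma S_pair_Suc:
  fixes x y :: "'a::comm_ring_1"
  assumes "x \<noteq> y"
  shows "S (Suc n) {x, y} = x * S n {x, y} + y ^ Suc n"
proof (induction n)
  case 0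
  show ?case
    by (simp add: S_pair[OF assms])
next
  case (Suc n)
  \<comment> \<open>The induction hypothesis times \<open>y\<close> cancels the subtracted term of
    the second-order recurrence.\<close>
  have "y * S (Suc n) {x, y} = x * y * S n {x, y} + y ^ Suc (Suc n)"
    by (simp add: Suc.IH algebra_simps)
  then show ?case
    by (simp only: S_pair(3)[OF assms]) (simp add: algebra_simps)
qed

text \<open>Two first-order steps leave \<open>x * y ^ (2 * n + 2)\<close> and
  \<open>y ^ (2 * n + 3)\<close>, with common factor \<open>y ^ (2 * n + 2)\<close>.\<close>

lemma S_pair_odd_Suc:
  fixes x y :: "'a::comm_ring_1"
  assumes "x \<noteq> y"
  shows "S (2 * Suc n + 1) {x, y} = x\<^sup>2 * S (2 * n + 1) {x, y} + (x + y) * y\<^sup>2 ^ Suc n"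
proof -
  have "S (2 * Suc n + 1) {x, y} = x * S (Suc (2 * n + 1)) {x, y} + y ^ Suc (Suc (2 * n + 1))"
    using S_pair_Suc[OF assms, of "Suc (2 * n + 1)"] by simp
  also have "\<dots> = x * (x * S (2 * n + 1) {x, y} + y ^ Suc (2 * n + 1)) + y ^ Suc (Suc (2 * n + 1))"
    by (simp only: S_pair_Suc[OF assms, of "2 * n + 1"])
  also have "\<dots> = x\<^sup>2 * S (2 * n + 1) {x, y} + (x + y) * y\<^sup>2 ^ Suc n"
    by (simp add: algebra_simps power2_eq_square power_mult_distrib flip: power_add mult_2)
  finally show ?thesis .
qed

text \<open>The weight \<open>c ^ (2 * n)\<close> amounts to substituting \<open>c^2 z\<close> for
  \<open>z\<close> in \<open>(1 - a z) (1 - b z)\<close>.\<close>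

lemma S_neg_pair_series:
  fixes a b c :: "'a::comm_ring_1"
  assumes "a \<noteq> b"
  shows "Abs_fps (\<lambda>n. S_neg n {a, b} * c ^ (2 * n)) =
    1 - fps_const ((a + b) * c\<^sup>2) * fps_X + fps_const (a * b * c\<^sup>2 ^ 2) * fps_X\<^sup>2"
  unfolding S_neg_def prod_pair[OF assms]
  by (rule fps_ext)
    (auto simp: not_less le_Suc_eq fps_X_power_nth fps_X_nth power_mult fps_mult_left_const_nth)

lemma quadratic_mult_S_pair_series:
  fixes a b w :: "'a::comm_ring_1"
  assumes "a \<noteq> b"
  shows "(1 - fps_const ((a + b) * w) * fps_X + fps_const (a * b * w\<^sup>2) * fps_X\<^sup>2) *
    Abs_fps (\<lambda>n. S n {a, b} * w ^ n) = 1" (is "?l = 1")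
proof (rule fps_ext)
  fix n
  consider "n = 0" | "n = Suc 0" | m where "n = Suc (Suc m)"
    by (metis not0_implies_Suc)
  then show "fps_nth ?l n = fps_nth 1 n"
    by cases (simp_all add: fps_nth_quadratic_mult S_pair[OF assms] algebra_simps power2_eq_square
        del: fps_const_mult fps_const_add)
qed

text \<open>In the coefficient of \<open>z^(m+2)\<close>, writing \<open>g (m + 1)\<close> and
  \<open>g (m + 2)\<close> in terms of \<open>g m = S (2 * m + 1) {x, y}\<close> makes
  \<open>g m\<close> drop out by the recurrence of \<open>S n {a, b}\<close>. The inhomogeneous
  terms that remain form the numerator.\<close>

lemma quadratic_mult_S_pair_product_series:
  fixes a b x y :: "'a::comm_ring_1"
  assumes "a \<noteq> b" and "x \<noteq> y"
  shows "(1 - fps_const ((a + b) * x\<^sup>2) * fps_X + fps_const (a * b * x\<^sup>2 ^ 2) * fps_X\<^sup>2) *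
      Abs_fps (\<lambda>n. S n {a, b} * S (2 * n + 1) {x, y}) =
    (fps_const (x + y) - fps_const (a * b * x\<^sup>2 * y\<^sup>2 * (x + y)) * fps_X\<^sup>2) *
      Abs_fps (\<lambda>n. S n {a, b} * y\<^sup>2 ^ n)" (is "?l = ?r")
proof (rule fps_ext)
  fix n
  define g where "g m = S (2 * m + 1) {x, y}" for m
  have g0: "g 0 = x + y"
    by (simp add: g_def S_pair[OF assms(2)])
  have gS: "g (Suc m) = x\<^sup>2 * g m + (x + y) * y\<^sup>2 ^ Suc m" for m
    unfolding g_def by (rule S_pair_odd_Suc[OF assms(2)])
  have r: "fps_nth ?r m = (x + y) * (S m {a, b} * y\<^sup>2 ^ m) -
      (if m < 2 then 0 else a * b * x\<^sup>2 * y\<^sup>2 * (x + y) * (S (m - 2) {a, b} * y\<^sup>2 ^ (m - 2)))" for m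
    by (simp add: left_diff_distrib mult.assoc fps_X_power_mult_nth
        del: fps_const_mult fps_const_add)
  consider "n = 0" | "n = Suc 0" | m where "n = Suc (Suc m)"
    by (metis not0_implies_Suc)
  then show "fps_nth ?l n = fps_nth ?r n"
    unfolding r g_def[symmetric]
    by cases (simp_all only: fps_nth_quadratic_mult fps_nth_Abs_fps S_pair[OF assms(1)] gS g0,
        simp_all add: algebra_simps power2_eq_square)
qed

theorem theorem3:
  fixes a1 a2 e1 e2 :: poly_ring and A E :: "poly_ring set"
  assumes "a1 = var A1" and "a2 = var A2" and "e1 = var E1" and "e2 = var E2"
    and "A = {a1, a2}" and "E = {e1, e2}"
  shows "Abs_fps (\<lambda>n. S n A * S (2 * n + 1) E) =
    (fps_const (e1 + e2) - fps_const (a1 * a2 * e1^2 * e2^2 * (e1 + e2)) * fps_X^2) *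
    fps_recip (Abs_fps (\<lambda>n. S_neg n A * e1^(2 * n)) * Abs_fps (\<lambda>n. S_neg n A * e2^(2 * n)))"
proof -
  have a: "a1 \<noteq> a2" and e: "e1 \<noteq> e2"
    using assms by (simp_all add: var_neq)
  define D where "D c = Abs_fps (\<lambda>n. S_neg n A * c ^ (2 * n))" for c
  define F where "F = Abs_fps (\<lambda>n. S n A * S (2 * n + 1) E)"
  define H where "H = Abs_fps (\<lambda>n. S n A * e2\<^sup>2 ^ n)"
  define N where "N = fps_const (e1 + e2) - fps_const (a1 * a2 * e1^2 * e2^2 * (e1 + e2)) * fps_X^2"
  note D = S_neg_pair_series[OF a, folded assms(5), folded D_def]
  have F: "D e1 * F = N * H"
    unfolding D F_def N_def H_def assms(5,6)
    by (rule quadratic_mult_S_pair_product_series[OF a e])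
  have H: "D e2 * H = 1"
    unfolding D H_def assms(5) by (rule quadratic_mult_S_pair_series[OF a])
  \<comment> \<open>Constant term 1 makes \<open>fps_recip\<close> a true inverse here, so
    \<open>F\<close> can be isolated without cancellation.\<close>
  have "fps_nth (D e1 * D e2) 0 = 1"
    by (simp add: D)
  then have R: "(D e1 * D e2) * fps_recip (D e1 * D e2) = 1"
    by (rule fps_recip_right)
  have "(D e1 * D e2) * F = D e2 * (D e1 * F)"
    by (simp only: ac_simps)
  also have "\<dots> = N * (D e2 * H)"
    by (simp only: F mult.left_commute)
  finally have "(D e1 * D e2) * F = N"
    by (simp only: H mult_1_right)
  then have "N * fps_recip (D e1 * D e2) = (D e1 * D e2) * F * fps_recip (D e1 * D e2)"
    by (simp only:)
  also have "\<dots> = F * ((D e1 * D e2) * fps_recip (D e1 * D e2))"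
    by (simp only: ac_simps)
  finally have "F = N * fps_recip (D e1 * D e2)"
    by (simp only: R mult_1_right)
  then show ?thesis
    unfolding F_def N_def D_def .
qed

end
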